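(* Let $X$ be a real uniformly convex Banach space and $K$ a nonempty closed convex subset of $X$. Let $N\ge 1$, let $T_1,\dots,T_N:K\to K$ and $I_1,\dots,I_N:K\to K$ be mappings such that: each $T_j$ is uniformly $L_1$-Lipschitzian and asymptotically quasi $I_j$-nonexpansive with a common (independent of $j$) sequence $\{\lambda_n\}\subset[1,\infty)$; each $I_j$ is uniformly $L_2$-Lipschitzian and asymptotically quasi-nonexpansive with a common sequence $\{\mu_n\}\subset[1,\infty)$; and $F=\bigcap_{j=1}^N\left(F(T_j)\cap F(I_j)\right)\neq\emptyset$. Put $B_{*}=\inf_n\beta_n$, $B^{*}=\sup_n\beta_n$, $\Lambda=\sup_n\lambda_n\ge 1$, $M=\sup_n\mu_n\ge 1$, and suppose that $\{\alpha_n\},\{\beta_n\},\{\gamma_n\},\{\widehat{\alpha}_n\},\{\widehat{\beta}_n\},\{\widehat{\gamma}_n\}$ are six sequences in $[0,1]$ satisfying: (i) $\alpha_n+\beta_n+\gamma_n=\widehat{\alpha}_n+\widehat{\beta}_n+\widehat{\gamma}_n=1$ for all $n\ge 1$; (ii) $\sum_{n=1}^{\infty}(\lambda_n\mu_n-1)\beta_n<\infty$; (iii) $0<B_{*}\le B^{*}<\dfrac{1}{\Lambda^2M^2}<1$; (iv) $0<\widehat B_{*}=\inf_n\widehat\beta_n\le\sup_n\widehat\beta_n=\widehat B^{*}<1$; (v) $\sum_{n=1}^\infty\gamma_n<\infty$ and $\sum_{n=1}^\infty\widehat{\gamma}_n<\infty$. Let $\{u_n\},\{v_n\}$ be bounded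 sequences in $K$ and let $\{x_n\}\subset K$ be the implicit iterative sequence with errors given by $x_0\in K$ and, for $n\ge 1$, $$x_n=\alpha_n x_{n-1}+\beta_n T_{j(n)}^{k(n)}y_n+\gamma_n u_n,\qquad y_n=\widehat{\alpha}_n x_n+\widehat{\beta}_n I_{j(n)}^{k(n)}x_n+\widehat{\gamma}_n v_n .$$ If at least one of the mappings $T_1,\dots,T_N,I_1,\dots,I_N$ is semi-compact, then $\{x_n\}$ converges strongly to a common fixed point of $\{T_j\}_{j=1}^N$ and $\{I_j\}_{j=1}^N$ (i.e. to a point of $F$).
   Context: For a mapping $T:K\to K$, $F(T)=\{x\in K: Tx=x\}$ is its set of fixed points, and $T^n$ is the $n$-th iterate. $I:K\to K$ is asymptotically quasi-nonexpansive with sequence $\{\mu_n\}\subset[1,\infty)$ if $\lim_{n\to\infty}\mu_n=1$ and $\|I^nx-p\|\le\mu_n\|x-p\|$ for all $x\in K$, $p\in F(I)$, $n\ge 1$. For $T,I:K\to K$, $T$ is asymptotically quasi $I$-nonexpansive with sequence $\{\lambda_n\}\subset[1,\infty)$ if $\lim_{n\to\infty}\lambda_n=1$ and $\|T^nx-p\|\le\lambda_n\|I^nx-p\|$ for all $x\in K$, $p\in F(T)\cap F(I)$, $n\ge 1$. $T:K\to K$ is uniformly $L$-Lipschitzian ($L>0$ a constant) if $\|T^nx-T^ny\|\le L\|x-y\|$ for all $x,y\in K$, $n\ge 1$. $T:K\to K$ is semi-compact if for any bounded sequence $\{x_n\}$ in $K$ with $\|x_n-Tx_n\|\to 0$ as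 $n\to\infty$ there exists a subsequence $\{x_{n_k}\}$ of $\{x_n\}$ converging strongly to some $x^*\in K$. For each integer $n\ge1$, $k(n)\ge 1$ and $j(n)\in\{1,\dots,N\}$ are the unique integers with $n=(k(n)-1)N+j(n)$. The sequence $\{x_n\}$ is understood as a sequence in $K$ satisfying the implicit equations above. *)

theory Defs
  imports "HOL-Analysis.Analysis"
begin

definition uniformly_convex :: "'a::real_normed_vector itself \<Rightarrow> bool" where
  "uniformly_convex _ \<longleftrightarrow>
     (\<forall>\<epsilon>. 0 < \<epsilon> \<and> \<epsilon> \<le> 2 \<longrightarrow>
        (\<exists>\<delta>>0. \<forall>x y :: 'a. norm x \<le> 1 \<longrightarrow> norm y \<le> 1 \<longrightarrow> \<epsilon> \<le> norm (x - y) \<longrightarrow>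
           norm (x + y) / 2 \<le> 1 - \<delta>))"

definition fixpts :: "'a set \<Rightarrow> ('a \<Rightarrow> 'a) \<Rightarrow> 'a set" where
  "fixpts K T = {x \<in> K. T x = x}"

text \<open>
  Sequences of constants are indexed by positive integers: their value at index \<open>0\<close> is never
  constrained. Maps are meant to satisfy \<open>T ` K \<subseteq> K\<close>, and their values outside \<open>K\<close> are irrelevant.
\<close>

definition asymp_quasi_nonexpansive ::
  "'a::real_normed_vector set \<Rightarrow> (nat \<Rightarrow> real) \<Rightarrow> ('a \<Rightarrow> 'a) \<Rightarrow> bool" where
  "asymp_quasi_nonexpansive K \<mu> I \<longleftrightarrow>
     (\<forall>n\<ge>1. 1 \<le> \<mu> n) \<and> \<mu> \<longlonglongrightarrow> 1 \<and>
     (\<forall>x\<in>K. \<forall>p\<in>fixpts K I. \<forall>n\<ge>1. norm ((I ^^ n) x - p) \<le> \<mu> n * norm (x - p))"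

definition asymp_quasi_rel_nonexpansive ::
  "'a::real_normed_vector set \<Rightarrow> (nat \<Rightarrow> real) \<Rightarrow> ('a \<Rightarrow> 'a) \<Rightarrow> ('a \<Rightarrow> 'a) \<Rightarrow> bool" where
  "asymp_quasi_rel_nonexpansive K l I T \<longleftrightarrow>
     (\<forall>n\<ge>1. 1 \<le> l n) \<and> l \<longlonglongrightarrow> 1 \<and>
     (\<forall>x\<in>K. \<forall>p\<in>fixpts K T \<inter> fixpts K I. \<forall>n\<ge>1.
        norm ((T ^^ n) x - p) \<le> l n * norm ((I ^^ n) x - p))"

definition uniformly_lipschitzian :: "'a::metric_space set \<Rightarrow> real \<Rightarrow> ('a \<Rightarrow> 'a) \<Rightarrow> bool" where
  "uniformly_lipschitzian K L T \<longleftrightarrow> 0 < L \<and> (\<forall>n\<ge>1. L-lipschitz_on K (T ^^ n))"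

definition semi_compact :: "'a::real_normed_vector set \<Rightarrow> ('a \<Rightarrow> 'a) \<Rightarrow> bool" where
  "semi_compact K T \<longleftrightarrow>
     (\<forall>x :: nat \<Rightarrow> 'a. range x \<subseteq> K \<longrightarrow> bounded (range x) \<longrightarrow>
        (\<lambda>n. norm (x n - T (x n))) \<longlonglongrightarrow> 0 \<longrightarrow>
        (\<exists>r z. strict_mono r \<and> z \<in> K \<and> (x \<circ> r) \<longlonglongrightarrow> z))"

end

theory Submission
  imports Defs
begin

text \<open>
  For every \<open>p \<in> F\<close> the implicit step gives
  \<open>norm (x n - p) \<le> (1 + s n) * norm (x (n - 1) - p) + e n\<close> with summable \<open>s\<close> and \<open>e\<close>, so that
  \<open>norm (x n - p)\<close> converges: solving for \<open>norm (x n - p)\<close> needs the upper bound on \<open>\<beta>\<close> in (iii), while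
  the lower bound makes \<open>\<lambda>\<^sub>n \<mu>\<^sub>n - 1\<close> itself summable, hence also along the exponents \<open>k n\<close>, each of
  which occurs \<open>N\<close> times. Uniform convexity, applied to the convex combinations that define \<open>x n\<close>
  and then \<open>y n\<close>, forces the combined points together. Hence consecutive iterates
  approach each other and \<open>x n\<close> is asymptotically fixed by the \<open>k n\<close>-th powers of \<open>T (j n)\<close> and \<open>I (j n)\<close>.
  Comparing the indices \<open>n\<close> and \<open>n + N\<close>, where \<open>j\<close> agrees and \<open>k\<close> increases by one, this passes to
  every single map. Semi-compactness then yields a cluster point, which lies in \<open>F\<close>, and convergence
  of the distance to that point finishes the argument.
\<close>

section \<open>Uniform convexity and convex combinations\<close>

lemma LIMSEQ_0_le:
  fixes f g :: "nat \<Rightarrow> real"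
  assumes "\<And>n. f n \<le> g n" "g \<longlonglongrightarrow> 0" "\<And>n. 0 \<le> f n"
  shows "f \<longlonglongrightarrow> 0"
  by (rule real_tendsto_sandwich[OF _ _ tendsto_const assms(2)]) (use assms in auto)

text \<open>Uniform convexity speaks only of midpoints in the unit ball. Scaling by
  \<open>1/s\<close> brings points of norm at most \<open>s\<close> there, and since
  \<open>s \<le> r\<close> their gap stays at least \<open>\<epsilon> / r\<close>; hence one
  \<open>\<delta>\<close> serves all radii up to \<open>r\<close>. Other weights reduce to the
  midpoint.\<close>

lemma uniformly_convex_combination:
  fixes r \<epsilon> :: real
  assumes "uniformly_convex TYPE('a::real_normed_vector)" "0 < \<epsilon>" "0 < r"
  shows "\<exists>\<delta>>0. \<forall>(a::'a) b t s c. norm a \<le> s \<longrightarrow> norm b \<le> s \<longrightarrow> \<epsilon> \<le> norm (a - b) \<longrightarrow> s \<le> r \<longrightarrow>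
      0 \<le> c \<longrightarrow> c \<le> t \<longrightarrow> t \<le> 1 - c \<longrightarrow> norm (t *\<^sub>R a + (1 - t) *\<^sub>R b) \<le> s * (1 - 2 * c * \<delta>)"
proof -
  \<comment> \<open>The cap 2 is the largest gap that \<open>uniformly_convex\<close> admits;
    lowering the gap only weakens what has to be checked.\<close>
  define e where "e = min 2 (\<epsilon> / r)"
  have "0 < e" "e \<le> 2"
    using assms by (auto simp: e_def)
  then obtain \<delta> where \<delta>: "0 < \<delta>"
    "\<And>x y::'a. norm x \<le> 1 \<Longrightarrow> norm y \<le> 1 \<Longrightarrow> e \<le> norm (x - y) \<Longrightarrow> norm (x + y) / 2 \<le> 1 - \<delta>"
    using assms(1) unfolding uniformly_convex_def by metis
  have half: "norm (t *\<^sub>R a + (1 - t) *\<^sub>R b) \<le> s * (1 - 2 * t * \<delta>)"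
    if ab: "norm a \<le> s" "norm b \<le> s" "\<epsilon> \<le> norm (a - b)" "s \<le> r" and t: "0 \<le> t" "t \<le> 1/2"
    for a b :: 'a and t s
  proof -
    have s: "0 < s"
    proof (rule ccontr)
      assume "\<not> 0 < s"
      then have "norm (a - b) \<le> 0"
        using ab(1,2) norm_triangle_ineq4[of a b] by linarith
      with ab(3) assms(2) show False by linarith
    qed
    have sub: "norm ((1/s) *\<^sub>R a - (1/s) *\<^sub>R b) = norm (a - b) / s"
      using s by (simp add: scaleR_diff_right[symmetric])
    have add: "norm ((1/s) *\<^sub>R a + (1/s) *\<^sub>R b) = norm (a + b) / s"
      using s by (simp add: scaleR_add_right[symmetric])
    have "\<epsilon> / r \<le> norm (a - b) / s"
      using ab s assms(2) by (intro frac_le) auto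
    then have "norm (a + b) / s / 2 \<le> 1 - \<delta>"
      using \<delta>(2)[of "(1/s) *\<^sub>R a" "(1/s) *\<^sub>R b"] ab s unfolding sub add
      by (simp add: e_def)
    then have mid: "norm (a + b) \<le> 2 * s * (1 - \<delta>)"
      using s by (simp add: field_simps)
    \<comment> \<open>The combination is the midpoint with weight \<open>2 * t\<close> plus
      \<open>b\<close> with weight \<open>1 - 2 * t\<close>; only the first part gains from
      \<open>\<delta>\<close>.\<close>
    have "t *\<^sub>R a + (1 - t) *\<^sub>R b = t *\<^sub>R (a + b) + (1 - 2 * t) *\<^sub>R b"
      by (simp add: algebra_simps flip: scaleR_left.add)
    also have "norm \<dots> \<le> t * norm (a + b) + (1 - 2 * t) * norm b"
      using t by (intro norm_triangle_le) simp
    also have "\<dots> \<le> t * (2 * s * (1 - \<delta>)) + (1 - 2 * t) * s"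
      using t mid ab(2) by (intro add_mono mult_left_mono) auto
    also have "\<dots> = s * (1 - 2 * t * \<delta>)"
      by (simp add: algebra_simps)
    finally show ?thesis .
  qed
  show ?thesis
  proof (intro exI[of _ \<delta>] conjI \<delta>(1) allI impI)
    fix a b :: 'a and t s c :: real
    assume ab: "norm a \<le> s" "norm b \<le> s" "\<epsilon> \<le> norm (a - b)" "s \<le> r"
      and c: "0 \<le> c" "c \<le> t" "t \<le> 1 - c"
    have s: "0 \<le> s"
      using ab(1) norm_ge_zero order_trans by blast
    \<comment> \<open>Exchanging \<open>a\<close> and \<open>b\<close> exchanges the weights, so the
      smaller weight can be taken as the one at most 1/2.\<close>
    define t' where "t' = min t (1 - t)"
    have t': "0 \<le> t'" "t' \<le> 1/2" "c \<le> t'"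
      using c unfolding t'_def by linarith+
    have "norm (t *\<^sub>R a + (1 - t) *\<^sub>R b) \<le> s * (1 - 2 * t' * \<delta>)"
    proof (cases "t \<le> 1/2")
      case True
      then have "t' = t" by (simp add: t'_def)
      then show ?thesis using half[of a s b t'] ab t' by simp
    next
      case False
      then have "t' = 1 - t" by (simp add: t'_def)
      then show ?thesis
        using half[of b s a t'] ab t' by (simp add: norm_minus_commute add.commute)
    qed
    also have "\<dots> \<le> s * (1 - 2 * c * \<delta>)"
      using s t'(3) \<delta>(1) by (intro mult_left_mono) auto
    finally show "norm (t *\<^sub>R a + (1 - t) *\<^sub>R b) \<le> s * (1 - 2 * c * \<delta>)" .
  qed
qed

text \<open>Schu's lemma.\<close>

lemma uniformly_convex_imp_diff_tendsto_0:
  fixes a b :: "nat \<Rightarrow> 'a::real_normed_vector"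
  assumes uc: "uniformly_convex TYPE('a)"
    and A: "\<And>n. norm (a n) \<le> A n" "A \<longlonglongrightarrow> d"
    and B: "\<And>n. norm (b n) \<le> B n" "B \<longlonglongrightarrow> d"
    and t: "0 < c" "\<And>n. c \<le> t n" "\<And>n. t n \<le> 1 - c"
    and comb: "(\<lambda>n. norm (t n *\<^sub>R a n + (1 - t n) *\<^sub>R b n)) \<longlonglongrightarrow> d"
  shows "(\<lambda>n. norm (a n - b n)) \<longlonglongrightarrow> 0"
proof -
  define s where "s n = max (A n) (B n)" for n
  have s: "s \<longlonglongrightarrow> d" "\<And>n. norm (a n) \<le> s n" "\<And>n. norm (b n) \<le> s n"
    using tendsto_max[OF A(2) B(2)] A(1) B(1) by (auto simp: s_def[abs_def] le_max_iff_disj)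
  have d0: "0 \<le> d"
    using comb by (rule LIMSEQ_le_const) auto
  show ?thesis
  \<comment> \<open>The gain from uniform convexity is proportional to the radius, so a zero limit
    is treated separately, by the triangle inequality.\<close>
  proof (cases "d = 0")
    case True
    have "norm (a n - b n) \<le> A n + B n" for n
      using A(1)[of n] B(1)[of n] norm_triangle_ineq4[of "a n" "b n"] by linarith
    moreover have "(\<lambda>n. A n + B n) \<longlonglongrightarrow> 0"
      using tendsto_add[OF A(2) B(2)] True by simp
    ultimately show ?thesis
      by (rule LIMSEQ_0_le) simp
  next
    case False
    with d0 have d: "0 < d" by simp
    show ?thesis
    proof (rule order_tendstoI)
      fix \<epsilon> :: real assume "0 < \<epsilon>"
      from d have "0 < d + 1" by simp
      from uniformly_convex_combination[OF uc \<open>0 < \<epsilon>\<close> this] obtain \<delta> where \<delta>: "0 < \<delta>"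
        "\<forall>(a::'a) b t s c. norm a \<le> s \<longrightarrow> norm b \<le> s \<longrightarrow> \<epsilon> \<le> norm (a - b) \<longrightarrow> s \<le> d + 1 \<longrightarrow>
          0 \<le> c \<longrightarrow> c \<le> t \<longrightarrow> t \<le> 1 - c \<longrightarrow> norm (t *\<^sub>R a + (1 - t) *\<^sub>R b) \<le> s * (1 - 2 * c * \<delta>)"
        by (elim exE conjE) (rule that)
      \<comment> \<open>A gap of at least \<open>\<epsilon>\<close> would bound the norm of the
        combination by \<open>s n * (1 - 2 * c * \<delta>)\<close>, whose limit is strictly below
        \<open>d\<close>. Hence such gaps stop occurring once \<open>s n\<close> is below
        \<open>d + 1\<close>.\<close>
      have "(\<lambda>n. norm (t n *\<^sub>R a n + (1 - t n) *\<^sub>R b n) - s n * (1 - 2 * c * \<delta>))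
          \<longlonglongrightarrow> d - d * (1 - 2 * c * \<delta>)"
        by (intro tendsto_intros comb s)
      moreover have "0 < d - d * (1 - 2 * c * \<delta>)"
        using d t(1) \<delta>(1) by (simp add: algebra_simps)
      ultimately have "\<forall>\<^sub>F n in sequentially.
          0 < norm (t n *\<^sub>R a n + (1 - t n) *\<^sub>R b n) - s n * (1 - 2 * c * \<delta>)"
        by (rule order_tendstoD(1))
      moreover have "\<forall>\<^sub>F n in sequentially. s n < d + 1"
        using order_tendstoD(2)[OF s(1)] by simp
      ultimately show "\<forall>\<^sub>F n in sequentially. norm (a n - b n) < \<epsilon>"
      proof eventually_elim
        case (elim n)
        show ?case
        proof (rule ccontr)
          assume "\<not> norm (a n - b n) < \<epsilon>"
          then have "norm (t n *\<^sub>R a n + (1 - t n) *\<^sub>R b n) \<le> s n * (1 - 2 * c * \<delta>)"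
            using elim(2) t by (intro \<delta>(2)[rule_format] s) auto
          with elim(1) show False by linarith
        qed
      qed
    qed (intro always_eventually allI less_le_trans[OF _ norm_ge_zero])
  qed
qed

section \<open>Convergence and summability of real sequences\<close>

lemma convergent_of_almost_decreasing:
  fixes a s t :: "nat \<Rightarrow> real"
  assumes a: "\<And>n. 0 \<le> a n" and s: "\<And>n. 0 \<le> s n" "summable s"
    and t: "\<And>n. 0 \<le> t n" "summable t"
    and step: "\<And>n. a (Suc n) \<le> (1 + s n) * a n + t n"
  shows "convergent a"
proof -
  \<comment> \<open>Since \<open>1 + s n \<le> exp (s n)\<close>, the weight \<open>exp (- S n)\<close> absorbs the factors and no product is needed.\<close>
  define S where "S n = (\<Sum>i<n. s i)" for n
  define U where "U n = (\<Sum>i<n. t i)" for n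
  have S: "convergent S" and U: "convergent U"
    unfolding S_def[abs_def] U_def[abs_def]
    using s(2) t(2) by (simp_all add: summable_iff_convergent)
  have S_nn: "0 \<le> S n" for n
    unfolding S_def by (intro sum_nonneg s(1))
  define b where "b n = a n * exp (- S n)" for n
  have b_step: "b (Suc n) \<le> b n + t n" for n
  proof -
    have "b (Suc n) \<le> ((1 + s n) * a n + t n) * exp (- S (Suc n))"
      unfolding b_def by (intro mult_right_mono step) auto
    also have "\<dots> \<le> exp (s n) * a n * exp (- S (Suc n)) + t n * exp (- S (Suc n))"
      using mult_right_mono[OF mult_right_mono[OF exp_ge_add_one_self[of "s n"] a[of n]],
          of "exp (- S (Suc n))"]
      by (simp add: distrib_right)
    also have "exp (s n) * a n * exp (- S (Suc n)) = b n"
      by (simp add: b_def S_def exp_add[symmetric] exp_diff exp_minus field_simps)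
    also have "t n * exp (- S (Suc n)) \<le> t n"
      using t(1)[of n] S_nn[of "Suc n"] by (intro mult_left_le) auto
    finally show ?thesis by simp
  qed
  \<comment> \<open>Subtracting the partial sums of \<open>t\<close> removes the additive errors and
    leaves a decreasing sequence, bounded below because \<open>t\<close> is summable.\<close>
  have "decseq (\<lambda>n. b n - U n)"
    using b_step by (intro decseq_SucI) (simp add: U_def algebra_simps)
  moreover have "- suminf t \<le> b n - U n" for n
  proof -
    have "0 \<le> b n" using a[of n] by (simp add: b_def)
    moreover have "U n \<le> suminf t"
      unfolding U_def using t by (intro sum_le_suminf) auto
    ultimately show ?thesis by simp
  qed
  ultimately have "convergent (\<lambda>n. b n - U n)"
    using decseq_convergent convergentI by blast
  moreover have "convergent (\<lambda>n. exp (S n))"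
    using S unfolding convergent_def by (blast intro: tendsto_exp)
  ultimately have "convergent (\<lambda>n. (b n - U n + U n) * exp (S n))"
    using U by (intro convergent_mult convergent_add)
  moreover have "(b n - U n + U n) * exp (S n) = a n" for n
    by (simp add: b_def mult.assoc exp_add[symmetric])
  ultimately show ?thesis by simp
qed

text \<open>Every value of \<open>f\<close> is repeated \<open>N\<close> times in a row, so the sum
  grows at most by the factor \<open>N\<close>. The exponents of the iteration follow this pattern:
  \<open>k (Suc n) - 1\<close> is \<open>n div N\<close>.\<close>

lemma summable_div_nat:
  fixes f :: "nat \<Rightarrow> real"
  assumes "\<And>n. 0 \<le> f n" "summable f" "1 \<le> N"
  shows "summable (\<lambda>n. f (n div N))"
proof (rule bounded_imp_summable)
  fix m
  have "(\<Sum>n\<le>m. f (n div N)) \<le> (\<Sum>n<Suc m * N. f (n div N))"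
  proof (rule sum_mono2)
    have "Suc m * 1 \<le> Suc m * N" using assms(3) by (intro mult_le_mono2)
    then show "{..m} \<subseteq> {..<Suc m * N}" by (auto simp del: mult_Suc intro: less_le_trans[of _ "Suc m"])
  qed (use assms(1) in auto)
  also have "\<dots> = (\<Sum>q<Suc m. \<Sum>n=q*N..<q*N+N. f (n div N))"
    by (rule sum.nat_group[symmetric])
  also have "\<dots> = (\<Sum>q<Suc m. real N * f q)"
  proof (rule sum.cong)
    fix q
    have "(\<Sum>n=q*N..<q*N+N. f (n div N)) = (\<Sum>n=q*N..<q*N+N. f q)"
    proof (rule sum.cong)
      fix n assume "n \<in> {q*N..<q*N+N}"
      then have "n div N = q"
        by (intro div_nat_eqI) (auto simp: mult.commute)
      then show "f (n div N) = f q" by simp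
    qed simp
    then show "(\<Sum>n=q*N..<q*N+N. f (n div N)) = real N * f q" by simp
  qed simp
  also have "\<dots> \<le> real N * suminf f"
    unfolding sum_distrib_left[symmetric]
    using assms by (intro mult_left_mono sum_le_suminf) auto
  finally show "(\<Sum>n\<le>m. f (n div N)) \<le> real N * suminf f" .
qed (use assms in auto)

section \<open>Cyclic indexing and residuals of single maps\<close>

lemma block_index_unique:
  fixes a b i j N :: nat
  assumes "a * N + i = b * N + j" "i \<in> {1..N}" "j \<in> {1..N}"
  shows "a = b \<and> i = j"
proof -
  \<comment> \<open>Offsets run through 1 to \<open>N\<close>, so they become remainders only after
    lowering them by one.\<close>
  have "(a * N + (i - 1)) div N = (b * N + (j - 1)) div N"
    using assms by (intro arg_cong[where f = "\<lambda>x. x div N"]) auto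
  moreover have "i - 1 < N" "j - 1 < N" "0 < N" using assms(2,3) by auto
  ultimately have "a = b" by (simp del: One_nat_def)
  with assms(1) show ?thesis by simp
qed

lemma funpow_mem:
  assumes "f ` K \<subseteq> K" "x \<in> K"
  shows "(f ^^ n) x \<in> K"
  using assms by (induction n) auto

lemma uniformly_lipschitzianD:
  assumes "uniformly_lipschitzian K L f" "x \<in> K" "y \<in> K" "1 \<le> n"
  shows "norm ((f ^^ n) x - (f ^^ n) y) \<le> L * norm (x - y)"
  using assms unfolding uniformly_lipschitzian_def by (metis dist_norm lipschitz_onD)

lemma shift_diff_tendsto_0:
  fixes x :: "nat \<Rightarrow> 'a::real_normed_vector"
  assumes "(\<lambda>n. norm (x (Suc n) - x n)) \<longlonglongrightarrow> 0"
  shows "(\<lambda>n. norm (x (n + l) - x n)) \<longlonglongrightarrow> 0"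
proof (induction l)
  case (Suc l)
  have lim: "(\<lambda>n. norm (x (Suc (n + l)) - x (n + l)) + norm (x (n + l) - x n)) \<longlonglongrightarrow> 0 + 0"
    by (intro tendsto_add Suc LIMSEQ_ignore_initial_segment[OF assms])
  have le: "norm (x (n + Suc l) - x n)
      \<le> norm (x (Suc (n + l)) - x (n + l)) + norm (x (n + l) - x n)" for n
    using norm_triangle_ineq[of "x (Suc (n + l)) - x (n + l)" "x (n + l) - x n"] by simp
  show ?case
    by (rule LIMSEQ_0_le[OF le]) (use lim in simp_all)
qed simp

text \<open>The residual of the \<open>k n\<close>-th power is first turned into one of the map
  \<open>T (j n)\<close> itself. Since every index \<open>i\<close> is active somewhere in each
  window of \<open>N\<close> steps, the vanishing steps of \<open>x\<close> then carry this over to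
  a fixed \<open>T i\<close>.\<close>

lemma cyclic_residual_tendsto_0:
  fixes T :: "nat \<Rightarrow> 'a::real_normed_vector \<Rightarrow> 'a"
  assumes maps: "\<And>i. i \<in> {1..N} \<Longrightarrow> T i ` K \<subseteq> K"
    and lip: "\<And>i. i \<in> {1..N} \<Longrightarrow> uniformly_lipschitzian K L (T i)"
    and kj: "\<And>n. n \<ge> 1 \<Longrightarrow> k n \<ge> 1 \<and> j n \<in> {1..N} \<and> n = (k n - 1) * N + j n"
    and x: "range x \<subseteq> K"
    and reg: "(\<lambda>n. norm (x (Suc n) - x n)) \<longlonglongrightarrow> 0"
    and res: "(\<lambda>n. norm (x (Suc n) - (T (j (Suc n)) ^^ k (Suc n)) (x (Suc n)))) \<longlonglongrightarrow> 0"
    and i: "i \<in> {1..N}"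
  shows "(\<lambda>n. norm (x n - T i (x n))) \<longlonglongrightarrow> 0"
proof -
  have xK: "x n \<in> K" for n using x by auto
  have L: "0 < L" using lip[OF i] by (simp add: uniformly_lipschitzian_def)
  define r where "r n = norm (x n - (T (j n) ^^ k n) (x n))" for n
  have r: "r \<longlonglongrightarrow> 0"
    using res unfolding r_def[symmetric] by (rule LIMSEQ_imp_Suc)
  note sh = shift_diff_tendsto_0[OF reg]
  have unique: "k n = q + 1 \<and> j n = l" if "n = q * N + l" "l \<in> {1..N}" for n q l
  proof -
    have n: "1 \<le> n" using that by simp
    have "(k n - 1) * N + j n = q * N + l" using kj[OF n] that(1) by simp
    then have "k n - 1 = q \<and> j n = l" using kj[OF n] that(2) by (intro block_index_unique) auto
    then show ?thesis using kj[OF n] by auto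
  qed
  define g where "g n = norm (x n - T (j n) (x n))" for n
  \<comment> \<open>At time \<open>n + N\<close> the same map acts with exponent
    \<open>k n + 1\<close>. Its first \<open>k n\<close> applications nearly fix
    \<open>x (n + N)\<close>, since they nearly fix the nearby \<open>x n\<close>; one further
    application costs a factor \<open>L\<close>.\<close>
  have g_le: "g (n + N) \<le> r (n + N) + L * ((L + 1) * norm (x (n + N) - x n) + r n)"
    if n: "1 \<le> n" for n
  proof -
    define q where "q = k n"
    define S where "S = T (j n)"
    have q: "1 \<le> q" and jn: "j n \<in> {1..N}" and nq: "n = (q - 1) * N + j n"
      using kj[OF n] by (auto simp: q_def)
    have "(q - 1) * N + N = q * N"
      using q by (cases q) auto
    then have "n + N = q * N + j n"
      using nq by linarith
    from unique[OF this jn] have kN: "k (n + N) = Suc q" "j (n + N) = j n" by auto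
    note Slip = uniformly_lipschitzianD[OF lip[OF jn], folded S_def]
    have SK: "(S ^^ q) z \<in> K" if "z \<in> K" for z
      using funpow_mem[OF maps[OF jn] that] by (simp add: S_def)
    let ?z = "x (n + N)"
    have 1: "norm ((S ^^ q) ?z - (S ^^ q) (x n)) \<le> L * norm (?z - x n)"
      using q by (intro Slip xK)
    have "norm ((S ^^ q) ?z - ?z) \<le> L * norm (?z - x n) + r n + norm (?z - x n)"
      using 1 norm_triangle_ineq[of "(S ^^ q) ?z - (S ^^ q) (x n)" "(S ^^ q) (x n) - ?z"]
        norm_triangle_ineq[of "(S ^^ q) (x n) - x n" "x n - ?z"]
      by (simp add: r_def S_def q_def norm_minus_commute)
    then have 2: "L * norm ((S ^^ q) ?z - ?z) \<le> L * ((L + 1) * norm (?z - x n) + r n)"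
      using L by (intro mult_left_mono) (auto simp: algebra_simps)
    have "norm ((S ^^ Suc q) ?z - S ?z) \<le> L * norm ((S ^^ q) ?z - ?z)"
      using Slip[of "(S ^^ q) ?z" ?z 1] SK xK by simp
    moreover have "g (n + N) \<le> r (n + N) + norm ((S ^^ Suc q) ?z - S ?z)"
      using norm_triangle_ineq[of "?z - (S ^^ Suc q) ?z" "(S ^^ Suc q) ?z - S ?z"]
      by (simp add: g_def r_def kN S_def)
    ultimately show ?thesis using 2 by linarith
  qed
  have "(\<lambda>n. r (n + N) + L * ((L + 1) * norm (x (n + N) - x n) + r n))
      \<longlonglongrightarrow> 0 + L * ((L + 1) * 0 + 0)"
    by (intro tendsto_intros sh r LIMSEQ_ignore_initial_segment[OF r])
  then have "(\<lambda>n. g (n + N)) \<longlonglongrightarrow> 0"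
    by (intro real_tendsto_sandwich[OF _ eventually_sequentiallyI[of 1, OF g_le] tendsto_const])
      (auto simp: g_def)
  then have g: "g \<longlonglongrightarrow> 0" by (rule LIMSEQ_offset)
  \<comment> \<open>The window starts at \<open>n + 1\<close>, because \<open>k\<close> and
    \<open>j\<close> are specified at positive indices only; this also covers
    \<open>n = 0\<close>.\<close>
  have ex: "\<exists>l\<le>N. j (n + l) = i" for n
  proof -
    define m where "m = Suc n"
    define q where "q = k m - 1"
    have m: "m = q * N + j m" "j m \<in> {1..N}" using kj[of m] by (auto simp: m_def q_def)
    show ?thesis
    proof (cases "j m \<le> i")
      case True
      have "n + (i + 1 - j m) = q * N + i" using m True unfolding m_def by linarith
      from unique[OF this i] have "j (n + (i + 1 - j m)) = i" by simp
      moreover have "i + 1 - j m \<le> N" using i m by auto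
      ultimately show ?thesis by blast
    next
      case False
      have "j m \<le> N" using m(2) by simp
      then have "n + (N + i + 1 - j m) = Suc q * N + i"
        using m(1) unfolding m_def mult_Suc by linarith
      from unique[OF this i] have "j (n + (N + i + 1 - j m)) = i" by simp
      moreover have "N + i + 1 - j m \<le> N" using False by auto
      ultimately show ?thesis by blast
    qed
  qed
  \<comment> \<open>The suitable shift \<open>l\<close> varies with \<open>n\<close>. Summing over
    all shifts gives a bound free of that choice, and it is a finite sum of null sequences.\<close>
  have le: "norm (x n - T i (x n)) \<le> (\<Sum>l\<le>N. (L + 1) * norm (x (n + l) - x n) + g (n + l))" for n
  proof -
    obtain l where l: "l \<le> N" "j (n + l) = i" using ex by blast
    have 1: "norm (T i (x (n + l)) - T i (x n)) \<le> L * norm (x (n + l) - x n)"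
      using uniformly_lipschitzianD[OF lip[OF i] xK xK, of 1] by simp
    have "norm (x n - T i (x n)) \<le> (L + 1) * norm (x (n + l) - x n) + g (n + l)"
      using 1 norm_triangle_ineq[of "x n - x (n + l)" "x (n + l) - T i (x n)"]
        norm_triangle_ineq[of "x (n + l) - T i (x (n + l))" "T i (x (n + l)) - T i (x n)"]
      unfolding g_def l distrib_right norm_minus_commute[of "x n" "x (n + l)"] by simp
    also have "\<dots> \<le> (\<Sum>l\<le>N. (L + 1) * norm (x (n + l) - x n) + g (n + l))"
      using l(1) L by (intro member_le_sum) (auto simp: g_def)
    finally show ?thesis .
  qed
  have "(\<lambda>n. \<Sum>l\<le>N. (L + 1) * norm (x (n + l) - x n) + g (n + l)) \<longlonglongrightarrow> (\<Sum>l\<le>N. (L + 1) * 0 + 0)"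
    by (intro tendsto_intros sh LIMSEQ_ignore_initial_segment[OF g])
  then show ?thesis
    by - (rule LIMSEQ_0_le[OF le], simp_all)
qed

lemma residual_limit_fixpoint:
  fixes f :: "'a::real_normed_vector \<Rightarrow> 'a"
  assumes lip: "uniformly_lipschitzian K L f"
    and x: "\<And>n. x n \<in> K" "x \<longlonglongrightarrow> z" "z \<in> K"
    and res: "(\<lambda>n. norm (x n - f (x n))) \<longlonglongrightarrow> 0"
  shows "z \<in> fixpts K f"
proof -
  have "L-lipschitz_on K (f ^^ 1)"
    using lip unfolding uniformly_lipschitzian_def by blast
  then have "L-lipschitz_on K f" by simp
  then have "continuous_on K f" by (rule lipschitz_on_continuous_on)
  then have "(\<lambda>n. f (x n)) \<longlonglongrightarrow> f z"
    using x by (intro continuous_on_tendsto_compose[of K f]) auto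
  then have "(\<lambda>n. norm (x n - f (x n))) \<longlonglongrightarrow> norm (z - f z)"
    using x by (intro tendsto_intros)
  then have "norm (z - f z) = 0" using res LIMSEQ_unique by blast
  then show ?thesis using x(3) by (simp add: fixpts_def)
qed

section \<open>Three-term convex combinations and the implicit recursion\<close>

lemma convexD3:
  assumes "convex S" "x \<in> S" "y \<in> S" "z \<in> S" "0 \<le> a" "0 \<le> b" "0 \<le> c" "a + b + c = 1"
  shows "a *\<^sub>R x + b *\<^sub>R y + c *\<^sub>R z \<in> S"
proof (cases "c = 1")
  case True
  then have "a = 0" "b = 0" using assms by linarith+
  then show ?thesis using True assms(4) by simp
next
  case False
  then have ab: "0 < a + b" using assms by linarith
  then have "a / (a + b) + b / (a + b) = 1"
    by (simp flip: add_divide_distrib)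
  with ab have "(a / (a + b)) *\<^sub>R x + (b / (a + b)) *\<^sub>R y \<in> S"
    using assms(2-6) by (intro convexD[OF assms(1)]) simp_all
  then have "(a + b) *\<^sub>R ((a / (a + b)) *\<^sub>R x + (b / (a + b)) *\<^sub>R y) + c *\<^sub>R z \<in> S"
    by (rule convexD[OF assms(1)]) (use ab assms in auto)
  then show ?thesis using ab by (simp add: scaleR_add_right)
qed

lemma norm_diff_convex3_le:
  fixes x y z p :: "'a::real_normed_vector"
  assumes "a + b + c = 1" "0 \<le> a" "0 \<le> b" "0 \<le> c"
  shows "norm (a *\<^sub>R x + b *\<^sub>R y + c *\<^sub>R z - p) \<le> a * norm (x - p) + b * norm (y - p) + c * norm (z - p)"
proof -
  have c: "c = 1 - a - b" using assms(1) by simp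
  have "a *\<^sub>R x + b *\<^sub>R y + c *\<^sub>R z - p = a *\<^sub>R (x - p) + b *\<^sub>R (y - p) + c *\<^sub>R (z - p)"
    unfolding c by (simp add: algebra_simps)
  also have "norm \<dots> \<le> norm (a *\<^sub>R (x - p)) + norm (b *\<^sub>R (y - p)) + norm (c *\<^sub>R (z - p))"
    by (intro norm_triangle_le add_right_mono norm_triangle_ineq)
  finally show ?thesis using assms by simp
qed

text \<open>Schu's lemma for a step with a vanishing error term. It is applied to the step from
  \<open>x n\<close> to \<open>x (Suc n)\<close> and again to the one from \<open>x (Suc n)\<close>
  to \<open>y (Suc n)\<close>.\<close>

lemma mann_step_with_errors_tendsto_0:
  fixes X Y Z :: "nat \<Rightarrow> 'a::real_normed_vector" and a b c :: "nat \<Rightarrow> real"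
  assumes uc: "uniformly_convex TYPE('a)"
    and sum1: "\<And>n. a n + b n + c n = 1" and c0: "\<And>n. 0 \<le> c n"
    and b: "0 < bl" "\<And>n. bl \<le> b n" "\<And>n. b n \<le> bu" "bu < 1"
    and c: "c \<longlonglongrightarrow> 0"
    and Z: "\<And>n. norm (Z n - p) \<le> C"
    and X: "(\<lambda>n. norm (X n - p)) \<longlonglongrightarrow> d"
    and Y: "\<And>n. norm (Y n - p) \<le> B n" "B \<longlonglongrightarrow> d"
    and W: "(\<lambda>n. norm (a n *\<^sub>R X n + b n *\<^sub>R Y n + c n *\<^sub>R Z n - p)) \<longlonglongrightarrow> d"
  shows "(\<lambda>n. norm (X n - Y n)) \<longlonglongrightarrow> 0"
    and "(\<lambda>n. norm (a n *\<^sub>R X n + b n *\<^sub>R Y n + c n *\<^sub>R Z n - X n)) \<longlonglongrightarrow> 0"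
proof -
  define E where "E n = c n *\<^sub>R (Z n - X n)" for n
  define e where "e n = c n * (C + norm (X n - p))" for n
  have "e \<longlonglongrightarrow> 0 * (C + d)"
    unfolding e_def by (intro tendsto_intros c X)
  then have e: "e \<longlonglongrightarrow> 0" by simp
  have Ee: "norm (E n) \<le> e n" for n
  proof -
    have "norm (Z n - X n) \<le> C + norm (X n - p)"
      using norm_triangle_ineq4[of "Z n - p" "X n - p"] Z[of n] by simp
    then show ?thesis
      using c0[of n] by (simp add: E_def e_def mult_left_mono)
  qed
  have a_eq: "a n = 1 - b n - c n" for n
    using sum1[of n] by simp
  \<comment> \<open>Spreading the error term over both points turns the step into a genuine two-point combination.\<close>
  have comb: "a n *\<^sub>R X n + b n *\<^sub>R Y n + c n *\<^sub>R Z n - p =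
      (1 - b n) *\<^sub>R (X n - p + E n) + (1 - (1 - b n)) *\<^sub>R (Y n - p + E n)" for n
    by (simp add: a_eq E_def algebra_simps)
  have "(\<lambda>n. norm ((X n - p + E n) - (Y n - p + E n))) \<longlonglongrightarrow> 0"
  proof (rule uniformly_convex_imp_diff_tendsto_0[OF uc])
    show "norm (X n - p + E n) \<le> norm (X n - p) + e n" for n
      using Ee[of n] norm_triangle_ineq[of "X n - p" "E n"] by linarith
    show "norm (Y n - p + E n) \<le> B n + e n" for n
      using Ee[of n] Y(1)[of n] norm_triangle_ineq[of "Y n - p" "E n"] by linarith
    show "(\<lambda>n. norm (X n - p) + e n) \<longlonglongrightarrow> d" "(\<lambda>n. B n + e n) \<longlonglongrightarrow> d"
      using tendsto_add[OF X e] tendsto_add[OF Y(2) e] by simp_all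
    show "0 < min bl (1 - bu)" using b by simp
    show "min bl (1 - bu) \<le> 1 - b n" "1 - b n \<le> 1 - min bl (1 - bu)" for n
      using b(2,3)[of n] by linarith+
    show "(\<lambda>n. norm ((1 - b n) *\<^sub>R (X n - p + E n) + (1 - (1 - b n)) *\<^sub>R (Y n - p + E n))) \<longlonglongrightarrow> d"
      using W unfolding comb .
  qed
  then show XY: "(\<lambda>n. norm (X n - Y n)) \<longlonglongrightarrow> 0" by simp
  have le: "norm (a n *\<^sub>R X n + b n *\<^sub>R Y n + c n *\<^sub>R Z n - X n) \<le> norm (X n - Y n) + e n" for n
  proof -
    have "a n *\<^sub>R X n + b n *\<^sub>R Y n + c n *\<^sub>R Z n - X n = b n *\<^sub>R (Y n - X n) + E n"
      by (simp add: a_eq E_def algebra_simps)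
    also have "norm \<dots> \<le> norm (b n *\<^sub>R (Y n - X n)) + norm (E n)"
      by (rule norm_triangle_ineq)
    also have "norm (b n *\<^sub>R (Y n - X n)) \<le> norm (X n - Y n)"
      using b(1) b(2,3)[of n] b(4) by (simp add: norm_minus_commute mult_left_le_one_le)
    finally show ?thesis using Ee[of n] by linarith
  qed
  show "(\<lambda>n. norm (a n *\<^sub>R X n + b n *\<^sub>R Y n + c n *\<^sub>R Z n - X n)) \<longlonglongrightarrow> 0"
    by (rule LIMSEQ_0_le[OF le]) (use tendsto_add[OF XY e] in simp_all)
qed

text \<open>The unknown \<open>A\<close> occurs on both sides, and \<open>c\<close> bounds from
  below its coefficient \<open>1 - b * (1 + s)\<close> after collecting terms. Working with
  \<open>A - A'\<close> leaves only the excess \<open>b * s\<close> in front of \<open>A'\<close>,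
  so the growth factor stays \<open>1 + s / c\<close>; nonnegativity of this difference is what the
  case split provides.\<close>

lemma implicit_recursion_bound:
  fixes A A' e b s c :: real
  assumes "0 \<le> A'" "0 \<le> e" "b \<le> 1" "0 \<le> s" "0 < c" "c \<le> 1 - b * (1 + s)"
    and "A \<le> (1 - b) * A' + b * (1 + s) * A + e"
  shows "A \<le> (1 + s / c) * A' + e / c"
proof (cases "A \<le> A'")
  case True
  have "0 \<le> s / c * A'" "0 \<le> e / c" using assms by simp_all
  then show ?thesis using True unfolding distrib_right by linarith
next
  case False
  have "c * (A - A') \<le> (1 - b * (1 + s)) * (A - A')"
    using assms(6) False by (intro mult_right_mono) auto
  also have "\<dots> \<le> b * (s * A') + e"
    using assms(7) by (simp add: algebra_simps)
  also have "\<dots> \<le> s * A' + e"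
    using assms mult_left_le[of b "s * A'"] by (simp add: mult.commute)
  finally have "A - A' \<le> (s * A' + e) / c"
    using assms(5) by (simp add: pos_le_divide_eq mult.commute)
  then show ?thesis
    by (simp add: add_divide_distrib algebra_simps)
qed

section \<open>Bounds for sequences indexed from one, and limits from subsequences\<close>

lemma bounded_image_norm_diff_le:
  fixes u :: "nat \<Rightarrow> 'a::real_normed_vector"
  assumes "bounded (u ` {1..})"
  obtains C where "0 \<le> C" "\<And>n. norm (u (Suc n) - p) \<le> C"
proof -
  from assms obtain e where e: "\<And>n. 1 \<le> n \<Longrightarrow> dist p (u n) \<le> e"
    unfolding bounded_any_center[where a = p] by auto
  then have le: "norm (u (Suc n) - p) \<le> e" for n
    using e[of "Suc n"] by (simp add: dist_norm norm_minus_commute)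
  moreover have "0 \<le> e" using order_trans[OF norm_ge_zero le] .
  ultimately show thesis by (rule that[rotated])
qed

lemma LIMSEQ_le_SUP:
  fixes f :: "nat \<Rightarrow> real"
  assumes "f \<longlonglongrightarrow> L" "1 \<le> n"
  shows "f n \<le> (SUP n\<in>{1..}. f n)"
proof (rule cSUP_upper)
  have "bounded (range f)" using assms(1) by (rule convergent_imp_bounded)
  then show "bdd_above (f ` {1..})"
    by (meson bdd_above_mono bounded_imp_bdd_above image_mono subset_UNIV)
qed (use assms(2) in simp)

lemma unit_interval_INF_SUP:
  fixes f :: "nat \<Rightarrow> real"
  assumes "\<And>n. 1 \<le> n \<Longrightarrow> f n \<in> {0..1}" "1 \<le> n"
  shows "(INF n\<in>{1..}. f n) \<le> f n" "f n \<le> (SUP n\<in>{1..}. f n)"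
proof -
  have "bdd_below (f ` {1..})" "bdd_above (f ` {1..})"
    using assms(1) by (auto intro!: bdd_belowI[of _ 0] bdd_aboveI[of _ 1])
  then show "(INF n\<in>{1..}. f n) \<le> f n" "f n \<le> (SUP n\<in>{1..}. f n)"
    using assms(2) by (auto intro: cINF_lower cSUP_upper)
qed

text \<open>The distances to \<open>z\<close> have a limit, which can be computed along the
  subsequence, where it is 0.\<close>

lemma convergent_norm_diff_imp_limit:
  fixes x :: "nat \<Rightarrow> 'a::real_normed_vector"
  assumes "convergent (\<lambda>n. norm (x n - z))" "(x \<circ> r) \<longlonglongrightarrow> z" "strict_mono r"
  shows "x \<longlonglongrightarrow> z"
proof -
  from assms(1) obtain d where d: "(\<lambda>n. norm (x n - z)) \<longlonglongrightarrow> d"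
    by (auto simp: convergent_def)
  have "((\<lambda>n. norm (x n - z)) \<circ> r) \<longlonglongrightarrow> d"
    using LIMSEQ_subseq_LIMSEQ[OF d assms(3)] .
  moreover have "(\<lambda>n. norm ((x \<circ> r) n - z)) \<longlonglongrightarrow> 0"
    by (rule tendsto_norm_zero[OF LIM_zero[OF assms(2)]])
  ultimately have "d = 0"
    using LIMSEQ_unique by (fastforce simp: o_def)
  with d show ?thesis
    by (simp add: LIM_zero_cancel tendsto_norm_zero_iff)
qed

theorem theorem3p5:
  fixes K :: "'a::banach set"
    and N :: nat
    and T I :: "nat \<Rightarrow> 'a \<Rightarrow> 'a"
    and L1 L2 :: real
    and lam \<mu> \<alpha> \<beta> \<gamma> \<alpha>h \<beta>h \<gamma>h :: "nat \<Rightarrow> real"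
    and F :: "'a set"
    and B_inf B_sup Bh_inf Bh_sup Lam M :: real
    and k j :: "nat \<Rightarrow> nat"
    and u v x y :: "nat \<Rightarrow> 'a"
  assumes "uniformly_convex TYPE('a)"
    and "K \<noteq> {}" and "closed K" and "convex K"
    and "N \<ge> 1"
    and "\<And>i. i \<in> {1..N} \<Longrightarrow> T i ` K \<subseteq> K"
    and "\<And>i. i \<in> {1..N} \<Longrightarrow> I i ` K \<subseteq> K"
    and "\<And>i. i \<in> {1..N} \<Longrightarrow> uniformly_lipschitzian K L1 (T i)"
    and "\<And>i. i \<in> {1..N} \<Longrightarrow> asymp_quasi_rel_nonexpansive K lam (I i) (T i)"
    and "\<And>i. i \<in> {1..N} \<Longrightarrow> uniformly_lipschitzian K L2 (I i)"
    and "\<And>i. i \<in> {1..N} \<Longrightarrow> asymp_quasi_nonexpansive K \<mu> (I i)"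
    and "F = (\<Inter>i\<in>{1..N}. fixpts K (T i) \<inter> fixpts K (I i))"
    and "F \<noteq> {}"
    and "B_inf = (INF n\<in>{1..}. \<beta> n)" and "B_sup = (SUP n\<in>{1..}. \<beta> n)"
    and "Bh_inf = (INF n\<in>{1..}. \<beta>h n)" and "Bh_sup = (SUP n\<in>{1..}. \<beta>h n)"
    and "Lam = (SUP n\<in>{1..}. lam n)" and "M = (SUP n\<in>{1..}. \<mu> n)"
    and "\<And>n. n \<ge> 1 \<Longrightarrow> \<alpha> n \<in> {0..1} \<and> \<beta> n \<in> {0..1} \<and> \<gamma> n \<in> {0..1}"
    and "\<And>n. n \<ge> 1 \<Longrightarrow> \<alpha>h n \<in> {0..1} \<and> \<beta>h n \<in> {0..1} \<and> \<gamma>h n \<in> {0..1}"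
    and "\<And>n. n \<ge> 1 \<Longrightarrow> \<alpha> n + \<beta> n + \<gamma> n = 1 \<and> \<alpha>h n + \<beta>h n + \<gamma>h n = 1"
    and "summable (\<lambda>n. (lam (Suc n) * \<mu> (Suc n) - 1) * \<beta> (Suc n))"
    and "0 < B_inf" and "B_inf \<le> B_sup"
    and "B_sup < 1 / (Lam\<^sup>2 * M\<^sup>2)" and "1 / (Lam\<^sup>2 * M\<^sup>2) < 1"
    and "0 < Bh_inf" and "Bh_inf \<le> Bh_sup" and "Bh_sup < 1"
    and "summable (\<lambda>n. \<gamma> (Suc n))" and "summable (\<lambda>n. \<gamma>h (Suc n))"
    and "u ` {1..} \<subseteq> K" and "bounded (u ` {1..})"
    and "v ` {1..} \<subseteq> K" and "bounded (v ` {1..})"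
    and "\<And>n. n \<ge> 1 \<Longrightarrow> k n \<ge> 1 \<and> j n \<in> {1..N} \<and> n = (k n - 1) * N + j n"
    and "range x \<subseteq> K"
    and "\<And>n. n \<ge> 1 \<Longrightarrow>
           x n = \<alpha> n *\<^sub>R x (n - 1) + \<beta> n *\<^sub>R (T (j n) ^^ k n) (y n) + \<gamma> n *\<^sub>R u n"
    and "\<And>n. n \<ge> 1 \<Longrightarrow>
           y n = \<alpha>h n *\<^sub>R x n + \<beta>h n *\<^sub>R (I (j n) ^^ k n) (x n) + \<gamma>h n *\<^sub>R v n"
    and "\<exists>i\<in>{1..N}. semi_compact K (T i) \<or> semi_compact K (I i)"
  shows "\<exists>p\<in>F. x \<longlonglongrightarrow> p"
proof -
  note uc = assms(1) and convex_K = assms(4) and N = assms(5)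
    and T_maps = assms(6) and I_maps = assms(7) and T_lip = assms(8) and T_aqn = assms(9)
    and I_lip = assms(10) and I_aqn = assms(11) and F = assms(12)
    and coeff = assms(20) and coeffh = assms(21) and sum1 = assms(22) and kj = assms(37)
    and x_eq = assms(39) and y_eq = assms(40)
  \<comment> \<open>The facts about the common sequences \<open>lam\<close> and \<open>\<mu>\<close>
    are read off from the maps with index 1.\<close>
  have one: "1 \<in> {1..N}" using N by simp
  have xK: "x n \<in> K" for n using assms(38) by auto
  have jN: "j (Suc n) \<in> {1..N}" and k1: "1 \<le> k (Suc n)" for n
    using kj[of "Suc n"] by simp_all

  have lam: "\<And>n. 1 \<le> n \<Longrightarrow> 1 \<le> lam n" "lam \<longlonglongrightarrow> 1"
    using T_aqn[OF one] by (auto simp: asymp_quasi_rel_nonexpansive_def)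
  have \<mu>: "\<And>n. 1 \<le> n \<Longrightarrow> 1 \<le> \<mu> n" "\<mu> \<longlonglongrightarrow> 1"
    using I_aqn[OF one] by (auto simp: asymp_quasi_nonexpansive_def)
  have lam_le: "lam n \<le> Lam" and \<mu>_le: "\<mu> n \<le> M" if "1 \<le> n" for n
    using LIMSEQ_le_SUP[OF lam(2) that] LIMSEQ_le_SUP[OF \<mu>(2) that] assms(18,19) by simp_all
  have Lam1: "1 \<le> Lam" and M1: "1 \<le> M"
    using lam(1)[of 1] \<mu>(1)[of 1] lam_le[of 1] \<mu>_le[of 1] by simp_all
  have \<beta>: "B_inf \<le> \<beta> (Suc n)" "\<beta> (Suc n) \<le> B_sup" for n
    using unit_interval_INF_SUP[of \<beta> "Suc n"] coeff assms(14,15) by simp_all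
  have \<beta>h: "Bh_inf \<le> \<beta>h (Suc n)" "\<beta>h (Suc n) \<le> Bh_sup" for n
    using unit_interval_INF_SUP[of \<beta>h "Suc n"] coeffh assms(16,17) by simp_all
  have co: "0 \<le> \<alpha> (Suc n)" "0 \<le> \<beta> (Suc n)" "0 \<le> \<gamma> (Suc n)" "\<beta> (Suc n) \<le> 1"
      "0 \<le> \<alpha>h (Suc n)" "0 \<le> \<beta>h (Suc n)" "0 \<le> \<gamma>h (Suc n)" for n
    using coeff[of "Suc n"] coeffh[of "Suc n"] by simp_all
  have sums: "\<alpha> (Suc n) + \<beta> (Suc n) + \<gamma> (Suc n) = 1" "\<alpha>h (Suc n) + \<beta>h (Suc n) + \<gamma>h (Suc n) = 1" for n
    using sum1[of "Suc n"] by simp_all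
  have B_sup1: "B_sup < 1" using assms(26,27) by linarith
  have \<gamma>_lim: "(\<lambda>n. \<gamma> (Suc n)) \<longlonglongrightarrow> 0" and \<gamma>h_lim: "(\<lambda>n. \<gamma>h (Suc n)) \<longlonglongrightarrow> 0"
    using assms(31,32) by (simp_all add: summable_LIMSEQ_zero)

  \<comment> \<open>Constants along the exponents and their summability\<close>
  define \<nu> where "\<nu> n = \<mu> (k (Suc n))" for n
  \<comment> \<open>A power of \<open>T\<close> is compared with the same power of \<open>I\<close>,
    and that one with the identity, so the two constants multiply.\<close>
  define \<kappa> where "\<kappa> n = lam (k (Suc n)) * \<mu> (k (Suc n))" for n
  have \<nu>1: "1 \<le> \<nu> n" for n unfolding \<nu>_def by (rule \<mu>(1)[OF k1])
  have \<nu>\<kappa>: "\<nu> n \<le> \<kappa> n" for n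
    using mult_right_mono[OF lam(1)[OF k1], of "\<nu> n" n] \<nu>1[of n] by (simp add: \<kappa>_def \<nu>_def)
  have \<kappa>1: "1 \<le> \<kappa> n" for n using \<nu>1 \<nu>\<kappa> order_trans by blast
  have \<nu>M: "\<nu> n \<le> M" for n unfolding \<nu>_def by (rule \<mu>_le[OF k1])
  have \<kappa>LM: "\<kappa> n \<le> Lam * M" for n
    unfolding \<kappa>_def using lam_le[OF k1] \<mu>_le[OF k1] Lam1 \<mu>(1)[OF k1, of n]
    by (intro mult_mono) auto

  have \<kappa>_sum: "summable (\<lambda>n. \<kappa> n - 1)"
  proof -
    define f where "f n = lam (Suc n) * \<mu> (Suc n) - 1" for n
    have f0: "0 \<le> f n" for n
      using mult_mono[OF lam(1)[of "Suc n"] \<mu>(1)[of "Suc n"]] lam(1)[of "Suc n"] by (simp add: f_def)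
    have "summable (\<lambda>n. f n * \<beta> (Suc n) / B_inf)"
      using assms(23) unfolding f_def by (rule summable_divide)
    \<comment> \<open>The positive lower bound of \<open>\<beta>\<close> removes the weight from the
      summability hypothesis.\<close>
    moreover have "norm (f n) \<le> f n * \<beta> (Suc n) / B_inf" for n
      using mult_left_mono[OF \<beta>(1) f0, of n] assms(24) f0[of n] by (simp add: pos_le_divide_eq)
    ultimately have "summable f" by (rule summable_comparison_test')
    then have "summable (\<lambda>n. f (n div N))" using f0 N by (intro summable_div_nat)
    moreover have "f (n div N) = \<kappa> n - 1" for n
    proof -
      \<comment> \<open>Division with remainder is one block decomposition of \<open>Suc n\<close>,
        so by uniqueness it is the one given by \<open>k\<close> and \<open>j\<close>.\<close>
      have "(n div N) * N + (n mod N + 1) = Suc n" by simp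
      also have "\<dots> = (k (Suc n) - 1) * N + j (Suc n)" using kj[of "Suc n"] by simp
      finally have "n div N = k (Suc n) - 1"
        using block_index_unique[of "n div N" N "n mod N + 1" "k (Suc n) - 1" "j (Suc n)"]
          jN[of n] N mod_less_divisor[of N n] by (auto simp: Suc_le_eq)
      then show ?thesis using k1[of n] by (simp add: f_def \<kappa>_def)
    qed
    ultimately show ?thesis by simp
  qed
  have \<kappa>_lim: "\<kappa> \<longlonglongrightarrow> 1"
    using LIM_zero_cancel[OF summable_LIMSEQ_zero[OF \<kappa>_sum]] .
  have \<nu>_lim: "\<nu> \<longlonglongrightarrow> 1"
    by (rule real_tendsto_sandwich[OF _ _ tendsto_const \<kappa>_lim]) (use \<nu>1 \<nu>\<kappa> in auto)
  \<comment> \<open>As \<open>\<nu>\<close> is at most \<open>\<kappa>\<close>, the excess is at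
    most that of the square of \<open>\<kappa>\<close>, which factors as
    \<open>(\<kappa> n + 1) * (\<kappa> n - 1)\<close> with bounded first factor.\<close>
  have \<kappa>\<nu>_sum: "summable (\<lambda>n. \<kappa> n * \<nu> n - 1)"
  proof (rule summable_comparison_test'[of _ 0])
    show "summable (\<lambda>n. (Lam * M + 1) * (\<kappa> n - 1))"
      by (intro summable_mult \<kappa>_sum)
    fix n
    have "1 \<le> \<kappa> n * \<nu> n" using mult_mono[OF \<kappa>1 \<nu>1, of n n] \<kappa>1[of n] by simp
    moreover have "\<kappa> n * \<nu> n - 1 \<le> (\<kappa> n + 1) * (\<kappa> n - 1)"
      using mult_left_mono[OF \<nu>\<kappa>, of "\<kappa> n" n] \<kappa>1[of n] by (simp add: algebra_simps)
    moreover have "(\<kappa> n + 1) * (\<kappa> n - 1) \<le> (Lam * M + 1) * (\<kappa> n - 1)"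
      using \<kappa>LM[of n] \<kappa>1[of n] by (intro mult_right_mono) auto
    ultimately show "norm (\<kappa> n * \<nu> n - 1) \<le> (Lam * M + 1) * (\<kappa> n - 1)" by simp
  qed

  \<comment> \<open>Distance estimates within one step\<close>
  define \<tau> where "\<tau> n = (T (j (Suc n)) ^^ k (Suc n)) (y (Suc n))" for n
  define \<iota> where "\<iota> n = (I (j (Suc n)) ^^ k (Suc n)) (x (Suc n))" for n
  have x_Suc: "x (Suc n) = \<alpha> (Suc n) *\<^sub>R x n + \<beta> (Suc n) *\<^sub>R \<tau> n + \<gamma> (Suc n) *\<^sub>R u (Suc n)" for n
    using x_eq[of "Suc n"] by (simp add: \<tau>_def)
  have y_Suc: "y (Suc n) = \<alpha>h (Suc n) *\<^sub>R x (Suc n) + \<beta>h (Suc n) *\<^sub>R \<iota> n + \<gamma>h (Suc n) *\<^sub>R v (Suc n)" for n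
    using y_eq[of "Suc n"] by (simp add: \<iota>_def)
  have yK: "y (Suc n) \<in> K" for n
  proof -
    have "\<iota> n \<in> K" "v (Suc n) \<in> K"
      using funpow_mem[OF I_maps[OF jN] xK] assms(35) by (auto simp: \<iota>_def)
    then show ?thesis
      unfolding y_Suc using co sums(2) xK convex_K by (intro convexD3) auto
  qed

  have \<iota>_le: "norm (\<iota> n - p) \<le> \<nu> n * norm (x (Suc n) - p)"
    and \<tau>_le: "norm (\<tau> n - p) \<le> \<kappa> n * norm (y (Suc n) - p)" if p: "p \<in> F" for p n
  proof -
    from p have pT: "p \<in> fixpts K (T (j (Suc n)))" and pI: "p \<in> fixpts K (I (j (Suc n)))"
      using jN unfolding F by blast+
    have I_le: "norm ((I (j (Suc n)) ^^ k (Suc n)) z - p) \<le> \<nu> n * norm (z - p)" if "z \<in> K" for z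
      using I_aqn[OF jN] that pI k1[of n] unfolding asymp_quasi_nonexpansive_def \<nu>_def by blast
    then show "norm (\<iota> n - p) \<le> \<nu> n * norm (x (Suc n) - p)"
      unfolding \<iota>_def using xK by blast
    have "norm (\<tau> n - p)
        \<le> lam (k (Suc n)) * norm ((I (j (Suc n)) ^^ k (Suc n)) (y (Suc n)) - p)"
      using T_aqn[OF jN] yK pT pI k1[of n] unfolding asymp_quasi_rel_nonexpansive_def \<tau>_def by blast
    also have "\<dots> \<le> lam (k (Suc n)) * (\<nu> n * norm (y (Suc n) - p))"
      using lam(1)[OF k1, of n] by (intro mult_left_mono I_le yK) auto
    finally show "norm (\<tau> n - p) \<le> \<kappa> n * norm (y (Suc n) - p)"
      by (simp add: \<kappa>_def \<nu>_def mult.assoc)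
  qed

  have y_le: "norm (y (Suc n) - p) \<le> \<nu> n * norm (x (Suc n) - p) + \<gamma>h (Suc n) * V"
    if p: "p \<in> F" and V: "norm (v (Suc n) - p) \<le> V" for p n V
  proof -
    let ?a = "norm (x (Suc n) - p)"
    have ah: "\<alpha>h (Suc n) = 1 - \<beta>h (Suc n) - \<gamma>h (Suc n)"
      using sums(2)[of n] by simp
    have "norm (y (Suc n) - p)
        \<le> \<alpha>h (Suc n) * ?a + \<beta>h (Suc n) * norm (\<iota> n - p) + \<gamma>h (Suc n) * norm (v (Suc n) - p)"
      unfolding y_Suc using co sums(2) by (intro norm_diff_convex3_le) auto
    \<comment> \<open>The first term is enlarged by \<open>\<nu> n\<close>, so that the first two
      weights can be added up to \<open>1 - \<gamma>h (Suc n)\<close>.\<close>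
    also have "\<dots> \<le> \<alpha>h (Suc n) * (\<nu> n * ?a) + \<beta>h (Suc n) * (\<nu> n * ?a) + \<gamma>h (Suc n) * V"
      using co V \<iota>_le[OF p] \<nu>1[of n] mult_right_mono[OF \<nu>1, of ?a n]
      by (intro add_mono mult_left_mono) auto
    also have "\<dots> = (1 - \<gamma>h (Suc n)) * (\<nu> n * ?a) + \<gamma>h (Suc n) * V"
      by (simp add: ah algebra_simps)
    also have "\<dots> \<le> \<nu> n * ?a + \<gamma>h (Suc n) * V"
      using co(5,6,7)[of n] \<nu>1[of n] ah by (intro add_right_mono mult_left_le_one_le) auto
    finally show ?thesis .
  qed

  \<comment> \<open>Convergence of the distances to a common fixed point\<close>
  have conv: "convergent (\<lambda>n. norm (x n - p))" if p: "p \<in> F" for p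
  proof -
    obtain U where U: "0 \<le> U" "\<And>n. norm (u (Suc n) - p) \<le> U"
      using bounded_image_norm_diff_le[OF assms(34)] by blast
    obtain V where V: "0 \<le> V" "\<And>n. norm (v (Suc n) - p) \<le> V"
      using bounded_image_norm_diff_le[OF assms(36)] by blast
    \<comment> \<open>Since \<open>\<kappa> n * \<nu> n\<close> is at most
      \<open>Lam\<^sup>2 * M\<^sup>2\<close>, this is a lower bound, uniform in \<open>n\<close>,
      for the coefficient left at the distance of \<open>x (Suc n)\<close>; it is positive by the
      upper bound on \<open>B_sup\<close>.\<close>
    define c where "c = 1 - B_sup * (Lam\<^sup>2 * M\<^sup>2)"
    have c: "0 < c"
      using assms(26) Lam1 M1 by (simp add: c_def pos_less_divide_eq)
    define s where "s n = \<kappa> n * \<nu> n - 1" for n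
    define e where "e n = Lam * M * V * \<gamma>h (Suc n) + U * \<gamma> (Suc n)" for n
    have s0: "0 \<le> s n" for n
      using mult_mono[OF \<kappa>1 \<nu>1, of n n] \<kappa>1[of n] by (simp add: s_def)
    have e0: "0 \<le> e n" for n
      using Lam1 M1 U(1) V(1) co by (simp add: e_def)
    have e_sum: "summable e"
      unfolding e_def by (intro summable_add summable_mult assms)
    show ?thesis
    proof (rule convergent_of_almost_decreasing)
      show "summable (\<lambda>n. s n / c)" "summable (\<lambda>n. e n / c)"
        using \<kappa>\<nu>_sum e_sum by (simp_all add: s_def summable_divide)
      show "0 \<le> s n / c" "0 \<le> e n / c" for n
        using s0 e0 c by simp_all
      show "norm (x (Suc n) - p) \<le> (1 + s n / c) * norm (x n - p) + e n / c" for n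
      proof (rule implicit_recursion_bound[of _ _ "\<beta> (Suc n)"])
        let ?a = "norm (x (Suc n) - p)"
        have "\<kappa> n * \<nu> n \<le> (Lam * M) * M"
          using \<kappa>LM \<nu>M \<nu>1[of n] Lam1 M1 by (intro mult_mono) auto
        also have "\<dots> \<le> Lam\<^sup>2 * M\<^sup>2"
          using Lam1 M1 by (simp add: power2_eq_square mult.assoc)
        finally have "\<kappa> n * \<nu> n \<le> Lam\<^sup>2 * M\<^sup>2" .
        from mult_mono[OF \<beta>(2)[of n] this] have "\<beta> (Suc n) * (\<kappa> n * \<nu> n) \<le> B_sup * (Lam\<^sup>2 * M\<^sup>2)"
          using \<beta>(2)[of n] co(2)[of n] s0[of n] by (simp add: s_def)
        then show "c \<le> 1 - \<beta> (Suc n) * (1 + s n)" by (simp add: c_def s_def)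
        have "norm (\<tau> n - p) \<le> \<kappa> n * (\<nu> n * ?a + \<gamma>h (Suc n) * V)"
          using \<tau>_le[OF p, of n] mult_left_mono[OF y_le[OF p V(2)], of "\<kappa> n" n] \<kappa>1[of n] by linarith
        also have "\<dots> \<le> (1 + s n) * ?a + Lam * M * V * \<gamma>h (Suc n)"
          using mult_right_mono[OF \<kappa>LM, of "\<gamma>h (Suc n) * V" n] co(7)[of n] V(1)
          by (simp add: s_def algebra_simps)
        finally have "\<beta> (Suc n) * norm (\<tau> n - p)
            \<le> \<beta> (Suc n) * ((1 + s n) * ?a + Lam * M * V * \<gamma>h (Suc n))"
          using co by (intro mult_left_mono)
        also have "\<dots> \<le> \<beta> (Suc n) * (1 + s n) * ?a + Lam * M * V * \<gamma>h (Suc n)"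
          unfolding distrib_left[of _ "_ * ?a"] mult.assoc[of _ _ ?a]
          using co[of n] Lam1 M1 V(1) by (intro add_left_mono mult_left_le_one_le) auto
        finally have \<tau>: "\<beta> (Suc n) * norm (\<tau> n - p)
            \<le> \<beta> (Suc n) * (1 + s n) * ?a + Lam * M * V * \<gamma>h (Suc n)" .
        have "?a \<le> \<alpha> (Suc n) * norm (x n - p) + \<beta> (Suc n) * norm (\<tau> n - p)
            + \<gamma> (Suc n) * norm (u (Suc n) - p)"
          by (subst x_Suc, intro norm_diff_convex3_le sums co)
        moreover have "\<alpha> (Suc n) * norm (x n - p) \<le> (1 - \<beta> (Suc n)) * norm (x n - p)"
          using sums(1)[of n] co(3)[of n] by (intro mult_right_mono) auto
        moreover have "\<gamma> (Suc n) * norm (u (Suc n) - p) \<le> U * \<gamma> (Suc n)"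
          using mult_left_mono[OF U(2) co(3), of n n] by (simp add: mult.commute)
        ultimately show "?a \<le> (1 - \<beta> (Suc n)) * norm (x n - p) + \<beta> (Suc n) * (1 + s n) * ?a + e n"
          using \<tau> unfolding e_def by linarith
      qed (use co s0 e0 c in auto)
    qed simp
  qed

  \<comment> \<open>Vanishing gaps between the points combined in each step\<close>
  obtain p where p: "p \<in> F" using assms(13) by blast
  obtain d where d: "(\<lambda>n. norm (x n - p)) \<longlonglongrightarrow> d"
    using conv[OF p] by (auto simp: convergent_def)
  note d_Suc = LIMSEQ_Suc[OF d]
  obtain U where U: "\<And>n. norm (u (Suc n) - p) \<le> U"
    using bounded_image_norm_diff_le[OF assms(34)] by blast
  obtain V where V: "\<And>n. norm (v (Suc n) - p) \<le> V"
    using bounded_image_norm_diff_le[OF assms(36)] by blast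
  have "(\<lambda>n. \<nu> n * norm (x (Suc n) - p) + \<gamma>h (Suc n) * V) \<longlonglongrightarrow> 1 * d + 0 * V"
    by (intro tendsto_intros \<nu>_lim d_Suc \<gamma>h_lim)
  then have y_bd: "(\<lambda>n. \<nu> n * norm (x (Suc n) - p) + \<gamma>h (Suc n) * V) \<longlonglongrightarrow> d" by simp
  have \<tau>_bd: "(\<lambda>n. \<kappa> n * (\<nu> n * norm (x (Suc n) - p) + \<gamma>h (Suc n) * V)) \<longlonglongrightarrow> d"
    using tendsto_mult[OF \<kappa>_lim y_bd] by simp
  have \<tau>_le': "norm (\<tau> n - p) \<le> \<kappa> n * (\<nu> n * norm (x (Suc n) - p) + \<gamma>h (Suc n) * V)" for n
    using \<tau>_le[OF p, of n] mult_left_mono[OF y_le[OF p V], of "\<kappa> n" n] \<kappa>1[of n] by linarith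
  \<comment> \<open>The combined point is \<open>x (Suc n)\<close> itself, so its distance to
    \<open>p\<close> tends to \<open>d\<close> by the convergence just proved.\<close>
  note step1 = mann_step_with_errors_tendsto_0[where Z = "\<lambda>n. u (Suc n)", OF uc sums(1) co(3) assms(24) \<beta> B_sup1 \<gamma>_lim U d
      \<tau>_le' \<tau>_bd, folded x_Suc, OF d_Suc]
  have x\<tau>: "(\<lambda>n. norm (x (Suc n) - \<tau> n)) \<longlonglongrightarrow> 0"
  proof (rule LIMSEQ_0_le)
    show "norm (x (Suc n) - \<tau> n) \<le> norm (x (Suc n) - x n) + norm (x n - \<tau> n)" for n
      using norm_triangle_ineq[of "x (Suc n) - x n" "x n - \<tau> n"] by simp
  qed (use tendsto_add[OF step1(2,1)] in simp_all)

  \<comment> \<open>The second use of uniform convexity needs the limit \<open>d\<close> for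
    \<open>y\<close> too. The lower bound comes from \<open>\<tau>\<close>: it is close to
    \<open>x (Suc n)\<close>, and its distance to \<open>p\<close> is at most
    \<open>\<kappa> n\<close> times that of \<open>y (Suc n)\<close>.\<close>
  have y_lim: "(\<lambda>n. norm (y (Suc n) - p)) \<longlonglongrightarrow> d"
  proof (rule real_tendsto_sandwich[OF _ _ _ y_bd])
    have "(\<lambda>n. (norm (x (Suc n) - p) - norm (x (Suc n) - \<tau> n)) / \<kappa> n) \<longlonglongrightarrow> (d - 0) / 1"
      by (intro tendsto_intros d_Suc x\<tau> \<kappa>_lim) simp
    then show "(\<lambda>n. (norm (x (Suc n) - p) - norm (x (Suc n) - \<tau> n)) / \<kappa> n) \<longlonglongrightarrow> d" by simp
    have "(norm (x (Suc n) - p) - norm (x (Suc n) - \<tau> n)) / \<kappa> n \<le> norm (y (Suc n) - p)" for n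
    proof -
      have "norm (x (Suc n) - p) - norm (x (Suc n) - \<tau> n) \<le> \<kappa> n * norm (y (Suc n) - p)"
        using \<tau>_le[OF p, of n] norm_triangle_ineq[of "x (Suc n) - \<tau> n" "\<tau> n - p"] by simp
      then show ?thesis using \<kappa>1[of n] by (simp add: pos_divide_le_eq mult.commute)
    qed
    then show "\<forall>\<^sub>F n in sequentially.
        (norm (x (Suc n) - p) - norm (x (Suc n) - \<tau> n)) / \<kappa> n \<le> norm (y (Suc n) - p)" by simp
    show "\<forall>\<^sub>F n in sequentially.
        norm (y (Suc n) - p) \<le> \<nu> n * norm (x (Suc n) - p) + \<gamma>h (Suc n) * V"
      using y_le[OF p V] by simp
  qed
  have \<iota>_bd: "(\<lambda>n. \<nu> n * norm (x (Suc n) - p)) \<longlonglongrightarrow> d"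
    using tendsto_mult[OF \<nu>_lim d_Suc] by simp
  note step2 = mann_step_with_errors_tendsto_0[where Z = "\<lambda>n. v (Suc n)", OF uc sums(2) co(7) assms(28) \<beta>h assms(30) \<gamma>h_lim V
      d_Suc \<iota>_le[OF p] \<iota>_bd, folded y_Suc, OF y_lim]
  \<comment> \<open>So far the power of \<open>T\<close> is evaluated at \<open>y\<close>; as
    \<open>y\<close> approaches \<open>x\<close>, the uniform Lipschitz bound moves it to
    \<open>x\<close>.\<close>
  have xT: "(\<lambda>n. norm (x (Suc n) - (T (j (Suc n)) ^^ k (Suc n)) (x (Suc n)))) \<longlonglongrightarrow> 0"
  proof (rule LIMSEQ_0_le)
    show "norm (x (Suc n) - (T (j (Suc n)) ^^ k (Suc n)) (x (Suc n)))
        \<le> norm (x (Suc n) - \<tau> n) + L1 * norm (y (Suc n) - x (Suc n))" for n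
      using uniformly_lipschitzianD[OF T_lip[OF jN[of n]] yK[of n] xK[of "Suc n"] k1[of n]]
        norm_triangle_ineq[of "x (Suc n) - \<tau> n" "\<tau> n - (T (j (Suc n)) ^^ k (Suc n)) (x (Suc n))"]
      by (simp add: \<tau>_def)
    show "(\<lambda>n. norm (x (Suc n) - \<tau> n) + L1 * norm (y (Suc n) - x (Suc n))) \<longlonglongrightarrow> 0"
      using tendsto_add[OF x\<tau> tendsto_mult[OF tendsto_const[of L1] step2(2)]] by simp
  qed simp

  \<comment> \<open>Residuals of the single maps, semi-compactness and the limit\<close>
  have T_res: "(\<lambda>n. norm (x n - T i (x n))) \<longlonglongrightarrow> 0" if "i \<in> {1..N}" for i
    using cyclic_residual_tendsto_0[OF T_maps T_lip kj assms(38) step1(2) xT that] .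
  have I_res: "(\<lambda>n. norm (x n - I i (x n))) \<longlonglongrightarrow> 0" if "i \<in> {1..N}" for i
    using cyclic_residual_tendsto_0[OF I_maps I_lip kj assms(38) step1(2) step2(1)[unfolded \<iota>_def] that] .

  have "bounded (range (\<lambda>n. norm (x n - p)))"
    using d by (rule convergent_imp_bounded)
  then obtain B where "\<And>n. norm (x n - p) \<le> B"
    unfolding bounded_iff by auto
  then have bdd: "bounded (range x)"
    unfolding bounded_any_center[where a = p] by (auto simp: dist_norm norm_minus_commute)
  \<comment> \<open>It does not matter which map is semi-compact: the residuals of all of them
    vanish along the bounded sequence \<open>x\<close>.\<close>
  obtain r z where r: "strict_mono r" "z \<in> K" "(x \<circ> r) \<longlonglongrightarrow> z"
    using assms(38,41) bdd T_res I_res unfolding semi_compact_def by blast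
  have sub: "(\<lambda>n. norm ((x \<circ> r) n - f ((x \<circ> r) n))) \<longlonglongrightarrow> 0"
    if "(\<lambda>n. norm (x n - f (x n))) \<longlonglongrightarrow> 0" for f
    using LIMSEQ_subseq_LIMSEQ[OF that r(1)] by (simp add: o_def)
  have "z \<in> F"
    unfolding F
  proof (intro INT_I IntI)
    fix i assume i: "i \<in> {1..N}"
    show "z \<in> fixpts K (T i)"
      by (rule residual_limit_fixpoint[OF T_lip[OF i] _ r(3,2) sub[OF T_res[OF i]]]) (simp add: xK)
    show "z \<in> fixpts K (I i)"
      by (rule residual_limit_fixpoint[OF I_lip[OF i] _ r(3,2) sub[OF I_res[OF i]]]) (simp add: xK)
  qed
  \<comment> \<open>\<open>conv\<close> holds for every point of \<open>F\<close>, hence also for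
    the cluster point \<open>z\<close>.\<close>
  then show ?thesis
    using convergent_norm_diff_imp_limit[OF conv r(3,1)] by blast
qed

end
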